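(* Let $r_1, r_2 \in \mathbb{N}$ with $r_1 < r_2$. If $r_1 \mid r_2$, then $GM(\beta^{\ast}, r_1) \subsetneq GM(\beta^{\ast}, r_2)$ (proper inclusion).
   Context: $\mathbb{N}=\{1,2,3,\dots\}$ and $[x]$ denotes the integer part of $x$. Sequences $a=(a_n)_{n\ge 1}$ are sequences of complex numbers indexed by the positive integers. For $r\in\mathbb{N}$, the class $GM(\beta^{\ast},r)$ is the set of all complex sequences $a=(a_n)$ for which there exist a real number $c>1$ and a constant $K(a)$ (both may depend on the sequence $a$, but not on $m$) such that for all $m\in\mathbb{N}$ $$\sum_{n=m}^{2m-1}|a_n-a_{n+r}|\le K(a)\,\beta^{\ast}_m,\qquad \beta^{\ast}_m=\sum_{k=m}^{m+r-1}|a_k|+\sum_{k=[m/c]}^{[cm]}\frac{|a_k|}{k}.$$ In the last sum only indices $k\ge 1$ are taken (i.e. if $[m/c]=0$ the sum starts at $k=1$). *)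

theory Defs
  imports Complex_Main
begin

text \<open>
  A complex sequence \<open>(a\<^sub>n)\<close> indexed by the positive integers is represented by a function
  \<open>a :: nat \<Rightarrow> complex\<close>. All indices below are at least 1, so the junk value \<open>a 0\<close> plays no role;
  in particular \<open>max 1\<close> drops the index 0 when the integer part of \<open>m / c\<close> vanishes.
\<close>

definition beta_star :: "nat \<Rightarrow> real \<Rightarrow> (nat \<Rightarrow> complex) \<Rightarrow> nat \<Rightarrow> real" where
  "beta_star r c a m =
     (\<Sum>k = m..m + r - 1. cmod (a k)) +
     (\<Sum>k = max 1 (nat \<lfloor>real m / c\<rfloor>)..nat \<lfloor>c * real m\<rfloor>. cmod (a k) / real k)"

definition GM_beta_star :: "nat \<Rightarrow> (nat \<Rightarrow> complex) set" where
  "GM_beta_star r =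
     {a. \<exists>c K :: real. c > 1 \<and>
        (\<forall>m\<ge>1. (\<Sum>n = m..2 * m - 1. cmod (a n - a (n + r))) \<le> K * beta_star r c a m)}"

end

theory Submission
  imports Defs
begin

text \<open>
  For the inclusion, write \<open>r\<^sub>2 = p * r\<^sub>1\<close> and telescope. For \<open>m \<ge> r\<^sub>2\<close> this bounds the sum of the
  differences with step \<open>r\<^sub>2\<close> by \<open>p\<close> times the sums with step \<open>r\<^sub>1\<close> over the blocks of \<open>m\<close> and of
  \<open>2 * m\<close>; the window of \<open>r\<^sub>1\<close> terms at \<open>2 * m\<close> exceeds the one at \<open>m\<close> by at most the variation over
  the block of \<open>m\<close>. For \<open>m < r\<^sub>2\<close> the weights \<open>1 / k\<close> are bounded below on all indices
  involved once \<open>c\<close> is large enough. The inclusion is proper because the indicator sequence of the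
  multiples of \<open>r\<^sub>2\<close> has vanishing differences with step \<open>r\<^sub>2\<close>, whereas those with step \<open>r\<^sub>1\<close> add up to
  at least \<open>m / r\<^sub>2\<close> over the block of \<open>m\<close>, and its majorant \<open>beta_star\<close> is bounded.
\<close>

section \<open>Half-open blocks and the logarithmic part of the majorant\<close>

definition log_window :: "real \<Rightarrow> (nat \<Rightarrow> complex) \<Rightarrow> nat \<Rightarrow> real" where
  "log_window c a m =
     (\<Sum>k = max 1 (nat \<lfloor>real m / c\<rfloor>)..nat \<lfloor>c * real m\<rfloor>. cmod (a k) / real k)"

lemma beta_star_eq_log_window:
  assumes "1 \<le> m"
  shows "beta_star r c a m = (\<Sum>k\<in>{m..<m + r}. cmod (a k)) + log_window c a m"
proof -
  have "{m..m + r - 1} = {m..<m + r}" using assms by auto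
  then show ?thesis by (simp add: beta_star_def log_window_def)
qed

text \<open>Half-open blocks concatenate and shift without truncated subtraction.\<close>

lemma mem_GM_beta_star_iff:
  "a \<in> GM_beta_star r \<longleftrightarrow> (\<exists>c K. c > 1 \<and>
     (\<forall>m\<ge>1. (\<Sum>n\<in>{m..<2 * m}. cmod (a n - a (n + r))) \<le> K * beta_star r c a m))"
proof -
  have "{m..2 * m - 1} = {m..<2 * m}" if "1 \<le> m" for m :: nat using that by auto
  then show ?thesis by (simp add: GM_beta_star_def)
qed

lemma log_window_nonneg: "0 \<le> log_window c a m"
  by (simp add: log_window_def sum_nonneg)

lemma beta_star_nonneg: "0 \<le> beta_star r c a m"
  by (simp add: beta_star_def add_nonneg_nonneg sum_nonneg)

text \<open>Serves to enlarge \<open>c\<close> and to replace the window at \<open>2 * m\<close> by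
  a wider one at \<open>m\<close>.\<close>

lemma log_window_mono:
  assumes "real m' / c' \<le> real m / c" and "c * real m \<le> c' * real m'"
  shows "log_window c a m \<le> log_window c' a m'"
  unfolding log_window_def
proof (rule sum_mono2)
  have "nat \<lfloor>real m' / c'\<rfloor> \<le> nat \<lfloor>real m / c\<rfloor>" "nat \<lfloor>c * real m\<rfloor> \<le> nat \<lfloor>c' * real m'\<rfloor>"
    using assms by (simp_all add: nat_mono floor_mono)
  then show "{max 1 (nat \<lfloor>real m / c\<rfloor>)..nat \<lfloor>c * real m\<rfloor>}
      \<subseteq> {max 1 (nat \<lfloor>real m' / c'\<rfloor>)..nat \<lfloor>c' * real m'\<rfloor>}"
    by (intro iffD2[OF atLeastatMost_subset_iff] disjI2 conjI max.mono) auto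
qed auto

text \<open>All of \<open>{m..<N}\<close> lies in the range of the logarithmic sum, and there each
  weight \<open>1 / k\<close> is at least \<open>1 / N\<close>. This is useful when \<open>N\<close>
  is bounded independently of \<open>m\<close>.\<close>

lemma sum_le_log_window:
  assumes "1 \<le> m" "1 < c" "real N \<le> c * real m"
  shows "(\<Sum>k\<in>{m..<N}. cmod (a k)) \<le> real N * log_window c a m"
proof -
  have "real m / c \<le> real m / 1"
    using assms by (intro divide_left_mono) auto
  then have lo: "nat \<lfloor>real m / c\<rfloor> \<le> m"
    by (metis div_by_1 floor_mono floor_of_nat nat_int nat_mono)
  have hi: "N \<le> nat \<lfloor>c * real m\<rfloor>"
    using assms(3) by (simp add: le_nat_floor)
  have "(\<Sum>k\<in>{m..<N}. cmod (a k)) \<le> (\<Sum>k\<in>{m..<N}. real N * (cmod (a k) / real k))"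
  proof (rule sum_mono)
    fix k assume k: "k \<in> {m..<N}"
    then have "0 < real k" "real k \<le> real N" using assms(1) by auto
    then have "cmod (a k) * real k \<le> cmod (a k) * real N"
      by (intro mult_left_mono) auto
    then show "cmod (a k) \<le> real N * (cmod (a k) / real k)"
      using \<open>0 < real k\<close> by (simp add: field_simps)
  qed
  also have "\<dots> = real N * (\<Sum>k\<in>{m..<N}. cmod (a k) / real k)"
    by (simp add: sum_distrib_left)
  also have "\<dots> \<le> real N * log_window c a m"
    unfolding log_window_def using lo hi assms(1)
    by (intro mult_left_mono sum_mono2) auto
  finally show ?thesis .
qed

text \<open>The range has at most \<open>c * m\<close> indices, and each weight in it is at most
  \<open>2 * c / m\<close>.\<close>

lemma log_window_le_of_bounded:
  assumes c: "1 < c" and m: "c \<le> real m" and bd: "\<And>k. cmod (a k) \<le> 1"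
  shows "log_window c a m \<le> 2 * c\<^sup>2"
proof -
  define x where "x = real m / c"
  define A where "A = {max 1 (nat \<lfloor>x\<rfloor>)..nat \<lfloor>c * real m\<rfloor>}"
  have x: "1 \<le> x" using c m by (simp add: x_def field_simps)
  have summand: "cmod (a k) / real k \<le> 2 / x" if "k \<in> A" for k
  proof -
    have "1 \<le> k" "nat \<lfloor>x\<rfloor> \<le> k" using that by (auto simp: A_def)
    \<comment> \<open>Rounding costs at most a factor 2:
      \<open>x < k + 1 \<le> 2 * k\<close>.\<close>
    then have "x / 2 \<le> real k" using x by linarith
    then have "x * cmod (a k) \<le> 2 * real k * 1"
      using x bd[of k] by (intro mult_mono) auto
    then show ?thesis using x \<open>1 \<le> k\<close> by (simp add: field_simps)
  qed
  have "log_window c a m \<le> real (card A) * (2 / x)"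
    unfolding log_window_def A_def[symmetric] x_def[symmetric]
    using summand by (rule sum_bounded_above)
  also have "card A \<le> nat \<lfloor>c * real m\<rfloor>"
    unfolding A_def by simp
  then have "real (card A) \<le> c * real m"
    using c of_nat_floor[of "c * real m"] by (meson mult_nonneg_nonneg of_nat_0_le_iff of_nat_mono
        order.trans less_imp_le zero_less_one)
  then have "real (card A) * (2 / x) \<le> c * real m * (2 / x)"
    using x by (intro mult_right_mono) auto
  also have "\<dots> = 2 * c\<^sup>2"
    using c m by (simp add: x_def power2_eq_square field_simps)
  finally show ?thesis .
qed

section \<open>From step \<open>r\<close> to step \<open>p * r\<close>\<close>

text \<open>Moving the window by one place trades its first term for the term \<open>r\<close>
  places later, so by the reverse triangle inequality the sum grows by at most one difference with
  step \<open>r\<close>.\<close>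

lemma window_shift_le:
  fixes a :: "nat \<Rightarrow> complex" and m t r :: nat
  shows "(\<Sum>k\<in>{m + t..<m + t + r}. cmod (a k))
     \<le> (\<Sum>k\<in>{m..<m + r}. cmod (a k)) + (\<Sum>n\<in>{m..<m + t}. cmod (a n - a (n + r)))"
proof (induction t)
  case (Suc t)
  let ?W = "\<lambda>s. \<Sum>k\<in>{s..<s + r}. cmod (a k)"
  have "?W (Suc (m + t)) + cmod (a (m + t)) = ?W (m + t) + cmod (a (m + t + r))"
    using sum.atLeast_Suc_lessThan[of "m + t" "Suc (m + t + r)" "\<lambda>k. cmod (a k)"]
      sum.atLeastLessThan_Suc[of "m + t" "m + t + r" "\<lambda>k. cmod (a k)"]
    by simp
  moreover have "cmod (a (m + t + r)) - cmod (a (m + t)) \<le> cmod (a (m + t) - a (m + t + r))"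
    by (metis norm_minus_commute norm_triangle_ineq2)
  ultimately show ?case using Suc.IH by simp
qed simp

lemma sum_diff_multiple_le:
  fixes a :: "nat \<Rightarrow> complex"
  assumes "p * r \<le> m"
  shows "(\<Sum>n\<in>{m..<2 * m}. cmod (a n - a (n + p * r)))
     \<le> real p * ((\<Sum>n\<in>{m..<2 * m}. cmod (a n - a (n + r)))
                + (\<Sum>n\<in>{2 * m..<2 * (2 * m)}. cmod (a n - a (n + r))))"
proof -
  define d where "d n = cmod (a n - a (n + r))" for n
  have tele: "cmod (a n - a (n + q * r)) \<le> (\<Sum>j<q. d (n + j * r))" for n q
  proof (induction q)
    case (Suc q)
    have "cmod (a n - a (n + Suc q * r))
        \<le> cmod (a n - a (n + q * r)) + cmod (a (n + q * r) - a (n + Suc q * r))"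
      by (metis diff_add_cancel add_diff_eq norm_triangle_ineq)
    also have "cmod (a (n + q * r) - a (n + Suc q * r)) = d (n + q * r)"
      by (simp add: d_def algebra_simps)
    finally show ?case using Suc.IH by simp
  qed simp
  have "(\<Sum>n\<in>{m..<2 * m}. cmod (a n - a (n + p * r)))
      \<le> (\<Sum>n\<in>{m..<2 * m}. \<Sum>j<p. d (n + j * r))"
    by (intro sum_mono tele)
  also have "\<dots> = (\<Sum>j<p. \<Sum>n\<in>{m..<2 * m}. d (n + j * r))"
    by (rule sum.swap)
  \<comment> \<open>As \<open>j * r \<le> m\<close>, every shifted block ends by
    \<open>3 * m\<close>. The range is extended to \<open>4 * m\<close> because it then splits into
    the blocks of \<open>m\<close> and \<open>2 * m\<close>, where the hypothesis on step
    \<open>r\<close> applies.\<close>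
  also have "\<dots> \<le> (\<Sum>j<p. sum d {m..<2 * (2 * m)})"
  proof (rule sum_mono)
    fix j assume "j \<in> {..<p}"
    then have "j * r \<le> m" using assms by (metis lessThan_iff less_imp_le mult_le_mono1 order_trans)
    have "(\<Sum>n\<in>{m..<2 * m}. d (n + j * r)) = sum d {m + j * r..<2 * m + j * r}"
      by (simp add: sum.shift_bounds_nat_ivl)
    also have "\<dots> \<le> sum d {m..<2 * (2 * m)}"
      using \<open>j * r \<le> m\<close> by (intro sum_mono2) (auto simp: d_def)
    finally show "(\<Sum>n\<in>{m..<2 * m}. d (n + j * r)) \<le> sum d {m..<2 * (2 * m)}" .
  qed
  also have "\<dots> = real p * (sum d {m..<2 * m} + sum d {2 * m..<2 * (2 * m)})"
    by (simp add: sum.atLeastLessThan_concat)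
  finally show ?thesis by (simp add: d_def)
qed

lemma sum_diff_le_sum_norm:
  fixes a :: "nat \<Rightarrow> complex" and m r :: nat
  shows "(\<Sum>n\<in>{m..<2 * m}. cmod (a n - a (n + r))) \<le> 2 * (\<Sum>k\<in>{m..<2 * m + r}. cmod (a k))"
proof -
  have "(\<Sum>n\<in>{m..<2 * m}. cmod (a n - a (n + r)))
      \<le> (\<Sum>n\<in>{m..<2 * m}. cmod (a n) + cmod (a (n + r)))"
    by (intro sum_mono norm_triangle_ineq4)
  also have "\<dots> = (\<Sum>k\<in>{m..<2 * m}. cmod (a k)) + (\<Sum>k\<in>{m + r..<2 * m + r}. cmod (a k))"
    by (simp add: sum.distrib sum.shift_bounds_nat_ivl)
  also have "\<dots> \<le> (\<Sum>k\<in>{m..<2 * m + r}. cmod (a k)) + (\<Sum>k\<in>{m..<2 * m + r}. cmod (a k))"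
    by (intro add_mono sum_mono2) auto
  finally show ?thesis by simp
qed

lemma GM_beta_star_subset_multiple:
  assumes "1 \<le> p"
  shows "GM_beta_star r \<subseteq> GM_beta_star (p * r)"
proof
  fix a assume "a \<in> GM_beta_star r"
  then obtain c K where c: "1 < c"
    and K: "\<And>m. 1 \<le> m \<Longrightarrow> (\<Sum>n\<in>{m..<2 * m}. cmod (a n - a (n + r))) \<le> K * beta_star r c a m"
    by (auto simp: mem_GM_beta_star_iff)
  define R where "R = p * r"
  \<comment> \<open>The part \<open>2 * c\<close> makes the window of \<open>C\<close> at
    \<open>m\<close> contain that of \<open>c\<close> at \<open>2 * m\<close>; the part
    \<open>R + 2\<close> gives \<open>2 * m + R \<le> C * m\<close> for all
    \<open>m \<ge> 1\<close>.\<close>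
  define C where "C = 2 * c + real R + 2"
  \<comment> \<open>The first summand serves \<open>m \<ge> R\<close>: with \<open>B\<close> the new
    majorant, the block of \<open>m\<close> contributes \<open>\<bar>K\<bar> * B\<close> and that of
    \<open>2 * m\<close> at most \<open>\<bar>K\<bar> * (1 + \<bar>K\<bar>) * B\<close>. The second
    serves \<open>m < R\<close>: a factor 2 from the triangle inequality and
    \<open>2 * m + R \<le> 3 * R\<close>.\<close>
  define K' where "K' = real p * (\<bar>K\<bar> * (2 + \<bar>K\<bar>)) + 6 * real R"
  have C: "1 < C" "2 * c \<le> C" using c by (auto simp: C_def)
  have "(\<Sum>n\<in>{m..<2 * m}. cmod (a n - a (n + R))) \<le> K' * beta_star R C a m" if m: "1 \<le> m" for m
  proof -
    define B where "B = beta_star R C a m"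
    have B0: "0 \<le> B" by (simp add: B_def beta_star_nonneg)
    define S where "S l = (\<Sum>n\<in>{l..<2 * l}. cmod (a n - a (n + r)))" for l
    define W where "W l = (\<Sum>k\<in>{l..<l + r}. cmod (a k))" for l
    have SK: "S l \<le> \<bar>K\<bar> * (W l + log_window c a l)" if "1 \<le> l" for l
    proof -
      have "S l \<le> K * beta_star r c a l" using K[OF that] by (simp add: S_def)
      \<comment> \<open>\<open>K\<close> may be negative; the absolute value makes the bound
        monotone in the majorant.\<close>
      also have "\<dots> \<le> \<bar>K\<bar> * beta_star r c a l"
        by (intro mult_right_mono beta_star_nonneg) simp
      finally show ?thesis using that by (simp add: beta_star_eq_log_window W_def)
    qed
    show ?thesis
    proof (cases "R \<le> m")
      case True
      have "r \<le> R" using assms by (simp add: R_def)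
      have W: "W m + log_window C a m \<le> B"
        unfolding B_def W_def beta_star_eq_log_window[OF m]
        using \<open>r \<le> R\<close> by (intro add_mono sum_mono2) auto
      have L1: "log_window c a m \<le> log_window C a m"
        using c C by (intro log_window_mono divide_left_mono mult_right_mono) auto
      have L2: "log_window c a (2 * m) \<le> log_window C a m"
      proof (rule log_window_mono)
        have "real m / C \<le> real m / c"
          using c C by (intro divide_left_mono) auto
        also have "\<dots> \<le> real (2 * m) / c"
          using c by (intro divide_right_mono) auto
        finally show "real m / C \<le> real (2 * m) / c" .
        have "(2 * c) * real m \<le> C * real m"
          using C(2) by (intro mult_right_mono) auto
        then show "c * real (2 * m) \<le> C * real m" by simp
      qed
      have "W (2 * m) \<le> W m + S m"
        using window_shift_le[of a m m r] by (simp add: W_def S_def mult_2)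
      moreover have "\<bar>K\<bar> * (W m + log_window c a m) \<le> \<bar>K\<bar> * B"
        using W L1 by (intro mult_left_mono) auto
      then have Sm: "S m \<le> \<bar>K\<bar> * B"
        using SK[OF m] by linarith
      ultimately have "W (2 * m) + log_window c a (2 * m) \<le> B + \<bar>K\<bar> * B"
        using W L2 by linarith
      then have "\<bar>K\<bar> * (W (2 * m) + log_window c a (2 * m)) \<le> \<bar>K\<bar> * (B + \<bar>K\<bar> * B)"
        by (intro mult_left_mono) auto
      then have "S (2 * m) \<le> \<bar>K\<bar> * (B + \<bar>K\<bar> * B)"
        using SK[of "2 * m"] m by linarith
      then have "S m + S (2 * m) \<le> \<bar>K\<bar> * (2 + \<bar>K\<bar>) * B"
        using Sm by (simp add: algebra_simps)
      then have "real p * (S m + S (2 * m)) \<le> real p * (\<bar>K\<bar> * (2 + \<bar>K\<bar>) * B)"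
        by (intro mult_left_mono) auto
      also have "\<dots> \<le> K' * B"
        using B0 by (simp add: K'_def algebra_simps)
      finally show ?thesis
        using sum_diff_multiple_le[of p r m a] True by (simp add: R_def S_def B_def)
    next
      case False
      then have "real (2 * m + R) \<le> 3 * real R" by simp
      have "real (2 * m + R) \<le> C * real m"
      proof -
        have "real R * 1 \<le> real R * real m" using m by (intro mult_left_mono) auto
        moreover have "0 \<le> c * real m" using c by simp
        ultimately show ?thesis by (simp add: C_def algebra_simps)
      qed
      then have "(\<Sum>k\<in>{m..<2 * m + R}. cmod (a k)) \<le> real (2 * m + R) * log_window C a m"
        by (intro sum_le_log_window m C)
      also have "\<dots> \<le> 3 * real R * B"
        unfolding B_def beta_star_eq_log_window[OF m] using \<open>real (2 * m + R) \<le> 3 * real R\<close>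
        by (intro mult_mono) (auto simp: log_window_nonneg sum_nonneg)
      finally have "(\<Sum>n\<in>{m..<2 * m}. cmod (a n - a (n + R))) \<le> 6 * real R * B"
        using sum_diff_le_sum_norm[of a R m] by simp
      also have "\<dots> \<le> K' * B"
        using B0 by (intro mult_right_mono) (auto simp: K'_def)
      finally show ?thesis by (simp add: B_def)
    qed
  qed
  then show "a \<in> GM_beta_star (p * r)"
    using C(1) by (auto simp: mem_GM_beta_star_iff R_def)
qed

section \<open>Properness of the inclusion\<close>

lemma indicator_multiples_in_GM_beta_star:
  "(\<lambda>n. if r dvd n then 1 else 0) \<in> GM_beta_star r"
  unfolding mem_GM_beta_star_iff by (intro exI[of _ 2] exI[of _ 0]) simp

lemma indicator_multiples_notin_GM_beta_star:
  assumes "1 \<le> s" "s < r"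
  shows "(\<lambda>n. if r dvd n then 1 else 0) \<notin> GM_beta_star s"
proof
  define a :: "nat \<Rightarrow> complex" where "a n = (if r dvd n then 1 else 0)" for n
  assume "(\<lambda>n. if r dvd n then 1 else 0) \<in> GM_beta_star s"
  then have "a \<in> GM_beta_star s" by (simp add: a_def[abs_def])
  then obtain c K where c: "1 < c"
    and K: "\<And>m. 1 \<le> m \<Longrightarrow> (\<Sum>n\<in>{m..<2 * m}. cmod (a n - a (n + s))) \<le> K * beta_star s c a m"
    by (auto simp: mem_GM_beta_star_iff)
  have a_le: "cmod (a k) \<le> 1" for k by (simp add: a_def)
  \<comment> \<open>\<open>t > c\<close> makes \<open>m = r * t\<close> large enough for the bound
    on the logarithmic sum; the other term of the maximum is the bound that the difference sum, at
    least \<open>t\<close>, will exceed.\<close>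
  obtain t where t: "real t > max c (\<bar>K\<bar> * (real s + 2 * c\<^sup>2))"
    using reals_Archimedean2 by blast
  define m where "m = r * t"
  have "t \<le> m" using assms by (simp add: m_def)
  then have cm: "c \<le> real m" and m: "1 \<le> m" using t c by linarith+
  have "(\<Sum>k\<in>{m..<m + s}. cmod (a k)) \<le> real s"
    using sum_bounded_above[of "{m..<m + s}" "\<lambda>k. cmod (a k)" 1] a_le by simp
  then have beta: "beta_star s c a m \<le> real s + 2 * c\<^sup>2"
    using log_window_le_of_bounded[OF c cm, of a] a_le by (simp add: beta_star_eq_log_window[OF m])
  \<comment> \<open>The multiples of \<open>r\<close> in the block of \<open>m\<close> are the
    \<open>r * i\<close> with \<open>t \<le> i < 2 * t\<close>; since \<open>0 < s < r\<close>, each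
    contributes exactly 1.\<close>
  have inj: "inj_on (\<lambda>i. r * i) {t..<2 * t}"
    using assms by (auto simp: inj_on_def)
  have diff: "cmod (a (r * i) - a (r * i + s)) = 1" for i
  proof -
    have "\<not> r dvd r * i + s" using assms by (simp add: dvd_add_right_iff nat_dvd_not_less)
    then show ?thesis by (simp add: a_def)
  qed
  have "real t = (\<Sum>i\<in>{t..<2 * t}. cmod (a (r * i) - a (r * i + s)))"
    by (simp add: diff)
  also have "\<dots> = (\<Sum>n\<in>(\<lambda>i. r * i) ` {t..<2 * t}. cmod (a n - a (n + s)))"
    by (simp add: sum.reindex[OF inj])
  also have "\<dots> \<le> (\<Sum>n\<in>{m..<2 * m}. cmod (a n - a (n + s)))"
    using assms by (intro sum_mono2) (auto simp: m_def)
  also have "\<dots> \<le> K * beta_star s c a m" by (rule K[OF m])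
  also have "\<dots> \<le> \<bar>K\<bar> * (real s + 2 * c\<^sup>2)"
    using beta by (intro mult_mono) (auto simp: beta_star_nonneg)
  finally show False using t by simp
qed

theorem theorem2:
  fixes r\<^sub>1 r\<^sub>2 :: nat
  assumes "1 \<le> r\<^sub>1" and "r\<^sub>1 < r\<^sub>2" and "r\<^sub>1 dvd r\<^sub>2"
  shows "GM_beta_star r\<^sub>1 \<subset> GM_beta_star r\<^sub>2"
proof -
  from \<open>r\<^sub>1 dvd r\<^sub>2\<close> obtain p where p: "r\<^sub>2 = p * r\<^sub>1" by (metis dvdE mult.commute)
  then have "1 \<le> p" using \<open>r\<^sub>1 < r\<^sub>2\<close> by (cases p) auto
  then have "GM_beta_star r\<^sub>1 \<subseteq> GM_beta_star r\<^sub>2"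
    unfolding p by (rule GM_beta_star_subset_multiple)
  then show ?thesis
    using indicator_multiples_in_GM_beta_star[of r\<^sub>2]
      indicator_multiples_notin_GM_beta_star[OF assms(1,2)] by blast
qed

end
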